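(* Let $T \in \mathscr{T}_{max}$, let $u \in V(T)$, and let $v$ be a new vertex not in $V(T)$. Let $T'$ be the tree with $V(T') = V(T) \cup \{v\}$ and $E(T') = E(T) \cup \{vu\}$. Then $T' \in \mathscr{T}_{max}$ if and only if $u$ is a support vertex of $T$, or $u$ is a leaf of $T$ whose adjacent support vertex is adjacent to at least two leaves.
   Context: A leaf is a vertex of degree 1; a support vertex is a vertex adjacent to a leaf. $N(v)$ denotes the open neighborhood of $v$. A set $S \subseteq V(G)$ is a locating-dominating (LD) set if for all $u,v \in V(G)-S$: $N(v)\cap S \neq \varnothing$, and if $u \ne v$ then $N(v) \cap S \neq N(u) \cap S$. A RED:LD set is an LD set $S$ such that $S-\{v\}$ is an LD set for every $v \in S$. $\textrm{RED:LD}(G)$ is the minimum cardinality of a RED:LD set of $G$. $\mathscr{T}_{max}$ is the family of all trees $T$ of order $n \ge 2$ with $\textrm{RED:LD}(T) = n$. *)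

theory Defs
  imports "Graph_Theory.Graph_Theory"
begin

text \<open>
  A finite simple graph is a \<open>pair_graph\<close>: a finite vertex set \<open>pverts G\<close> together with a
  symmetric irreflexive relation \<open>parcs G\<close>, each edge \<open>xy\<close> being the two arcs \<open>(x, y)\<close> and
  \<open>(y, x)\<close>.  The library predicate \<open>tree\<close> cannot be used for such graphs: its \<open>forest\<close> part
  forbids directed cycles, and every edge of a symmetric digraph is a directed cycle of length
  two.  The cycles of the underlying simple graph are the ones of length at least three.
\<close>

definition undirected_tree :: "'a pair_pre_digraph \<Rightarrow> bool" where
  "undirected_tree G \<longleftrightarrow>
     pair_graph G \<and> connected (with_proj G) \<and>
     \<not> (\<exists>p. pre_digraph.cycle (with_proj G) p \<and> 3 \<le> length p)"

definition open_nbhd :: "'a pair_pre_digraph \<Rightarrow> 'a \<Rightarrow> 'a set" where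
  "open_nbhd G v = {w. v \<rightarrow>\<^bsub>with_proj G\<^esub> w}"

text \<open>In a symmetric digraph the out-degree is the degree of the underlying simple graph.\<close>

definition leaf :: "'a pair_pre_digraph \<Rightarrow> 'a \<Rightarrow> bool" where
  "leaf G v \<longleftrightarrow> v \<in> pverts G \<and> out_degree (with_proj G) v = 1"

definition support_vertex :: "'a pair_pre_digraph \<Rightarrow> 'a \<Rightarrow> bool" where
  "support_vertex G v \<longleftrightarrow> v \<in> pverts G \<and> (\<exists>w \<in> open_nbhd G v. leaf G w)"

definition LD_set :: "'a pair_pre_digraph \<Rightarrow> 'a set \<Rightarrow> bool" where
  "LD_set G S \<longleftrightarrow> S \<subseteq> pverts G \<and>
     (\<forall>u \<in> pverts G - S. \<forall>v \<in> pverts G - S.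
        open_nbhd G v \<inter> S \<noteq> {} \<and>
        (u \<noteq> v \<longrightarrow> open_nbhd G v \<inter> S \<noteq> open_nbhd G u \<inter> S))"

definition RED_LD_set :: "'a pair_pre_digraph \<Rightarrow> 'a set \<Rightarrow> bool" where
  "RED_LD_set G S \<longleftrightarrow> LD_set G S \<and> (\<forall>v \<in> S. LD_set G (S - {v}))"

text \<open>Unspecified if \<open>G\<close> has no RED:LD set; by \<open>RED_LD_set_pverts\<close> below this does not happen
  for trees of order at least two.\<close>

definition RED_LD :: "'a pair_pre_digraph \<Rightarrow> nat" where
  "RED_LD G = (LEAST k. \<exists>S. RED_LD_set G S \<and> card S = k)"

definition T_max :: "'a pair_pre_digraph set" where
  "T_max = {T. undirected_tree T \<and> 2 \<le> card (pverts T) \<and> RED_LD T = card (pverts T)}"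

lemma RED_LD_set_pverts:
  assumes "undirected_tree G" "2 \<le> card (pverts G)"
  shows "RED_LD_set G (pverts G)"
proof -
  interpret pair_graph G using assms(1) by (simp add: undirected_tree_def)
  have nbr: "\<exists>w. w \<in> open_nbhd G v" if v: "v \<in> pverts G" for v
  proof -
    have "pverts G \<noteq> {v}" using assms(2) by auto
    then obtain w where w: "w \<in> pverts G" "w \<noteq> v" using v by auto
    have "strongly_connected (with_proj G)"
      using assms(1) pair_sym_arcs
      by (simp add: undirected_tree_def symmetric_connected_imp_strongly_connected)
    then have "v \<rightarrow>\<^sup>*\<^bsub>with_proj G\<^esub> w" using v w by (auto simp: strongly_connected_def)
    then show ?thesis using w(2)
      by (cases rule: converse_reachable_cases) (auto simp: open_nbhd_def)
  qed
  have loop: "v \<notin> open_nbhd G v" for v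
    using pair_no_loops[of "(v, v)"] by (auto simp: open_nbhd_def)
  have sub: "open_nbhd G v \<subseteq> pverts G" for v
    using in_arcsD2 by (auto simp: open_nbhd_def)
  have "open_nbhd G v \<inter> (pverts G - {v}) \<noteq> {}" if "v \<in> pverts G" for v
    using nbr[OF that] loop[of v] sub[of v] by blast
  then show ?thesis
    by (auto simp: RED_LD_set_def LD_set_def)
qed

end

theory Submission
  imports Defs
begin

text \<open>
  A superset of a RED:LD set is a RED:LD set, so a tree of order at least two lies in
  \<open>T_max\<close> iff no single vertex can be dropped from its vertex set.  A vertex \<open>x\<close> cannot be dropped
  iff some \<open>y \<noteq> x\<close> satisfies \<open>N(x) \<subseteq> {y}\<close>, \<open>N(y) \<subseteq> {x}\<close> or \<open>N(x) - {y} = N(y) - {x}\<close>.  In the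
  first two cases \<open>x\<close> is a leaf or a support vertex, and in the last one \<open>x\<close> is a leaf, because
  otherwise there is a cycle of length three or four.  Hence \<open>T_max\<close> consists of the trees in which
  every vertex is a leaf or a support vertex.  Attaching a leaf to \<open>u\<close> destroys this property only
  if \<open>u\<close> was the unique leaf at a vertex that is not itself a leaf.
\<close>

section \<open>Leaves and monotonicity of LD and RED:LD sets\<close>

lemma mem_open_nbhd [simp]: "w \<in> open_nbhd G v \<longleftrightarrow> (v, w) \<in> parcs G"
  by (simp add: open_nbhd_def)

lemma leaf_iff: "leaf G v \<longleftrightarrow> v \<in> pverts G \<and> (\<exists>s. open_nbhd G v = {s})"
proof -
  have "out_arcs (with_proj G) v = Pair v ` open_nbhd G v"
    by (auto simp: out_arcs_def)
  then have "out_degree (with_proj G) v = card (open_nbhd G v)"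
    by (simp add: out_degree_def card_image inj_on_def)
  then show ?thesis
    by (simp add: leaf_def card_1_singleton_iff)
qed

text \<open>Enlarging the set leaves fewer vertices to check, and traces of neighborhoods that are
  nonempty or distinct on \<open>S\<close> stay so on \<open>S'\<close>.\<close>

lemma LD_set_mono:
  assumes "LD_set G S" "S \<subseteq> S'" "S' \<subseteq> pverts G"
  shows "LD_set G S'"
  unfolding LD_set_def
proof (intro conjI ballI impI)
  fix a b assume ab: "a \<in> pverts G - S'" "b \<in> pverts G - S'"
  then have ab': "a \<in> pverts G - S" "b \<in> pverts G - S"
    using assms(2) by auto
  show "open_nbhd G b \<inter> S' \<noteq> {}"
    using ab' assms(1,2) unfolding LD_set_def by blast
  assume "a \<noteq> b"
  then have "open_nbhd G b \<inter> S \<noteq> open_nbhd G a \<inter> S"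
    using ab' assms(1) unfolding LD_set_def by blast
  then show "open_nbhd G b \<inter> S' \<noteq> open_nbhd G a \<inter> S'"
    using assms(2) by blast
qed (fact assms(3))

text \<open>When \<open>w\<close> is deleted from \<open>S'\<close>, the rest still contains an LD
  set: \<open>S - {w}\<close> if \<open>w\<close> lies in \<open>S\<close>, and \<open>S\<close>
  itself otherwise.\<close>

lemma RED_LD_set_mono:
  assumes "RED_LD_set G S" "S \<subseteq> S'" "S' \<subseteq> pverts G"
  shows "RED_LD_set G S'"
  unfolding RED_LD_set_def
proof (intro conjI ballI)
  show "LD_set G S'"
    using assms LD_set_mono unfolding RED_LD_set_def by blast
  fix w assume "w \<in> S'"
  show "LD_set G (S' - {w})"
  proof (cases "w \<in> S")
    case True
    then have "LD_set G (S - {w})"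
      using assms(1) by (auto simp: RED_LD_set_def)
    then show ?thesis
      by (rule LD_set_mono) (use assms in auto)
  next
    case False
    have "LD_set G S"
      using assms(1) by (auto simp: RED_LD_set_def)
    then show ?thesis
      by (rule LD_set_mono) (use assms False in auto)
  qed
qed

text \<open>A RED:LD set smaller than the whole vertex set misses some \<open>x\<close>, and by
  monotonicity it can be enlarged to \<open>pverts G - {x}\<close>. So deletions of one vertex
  decide whether the minimum is the order.\<close>

lemma RED_LD_eq_order_iff:
  assumes "undirected_tree G" "2 \<le> card (pverts G)"
  shows "RED_LD G = card (pverts G) \<longleftrightarrow> (\<forall>x\<in>pverts G. \<not> RED_LD_set G (pverts G - {x}))"
proof -
  have fin: "finite (pverts G)"
    using assms(2) by (intro card_ge_0_finite) auto
  let ?P = "\<lambda>k. \<exists>S. RED_LD_set G S \<and> card S = k"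
  have V: "?P (card (pverts G))"
    using RED_LD_set_pverts[OF assms] by blast
  show ?thesis
  proof
    assume eq: "RED_LD G = card (pverts G)"
    show "\<forall>x\<in>pverts G. \<not> RED_LD_set G (pverts G - {x})"
    proof (intro ballI notI)
      fix x assume x: "x \<in> pverts G" and "RED_LD_set G (pverts G - {x})"
      then have "RED_LD G \<le> card (pverts G - {x})"
        unfolding RED_LD_def by (intro Least_le) blast
      also have "\<dots> < card (pverts G)"
        using fin x by (rule card_Diff1_less)
      finally show False using eq by simp
    qed
  next
    assume none: "\<forall>x\<in>pverts G. \<not> RED_LD_set G (pverts G - {x})"
    have "?P (RED_LD G)"
      unfolding RED_LD_def using V by (rule LeastI)
    then obtain S where S: "RED_LD_set G S" "card S = RED_LD G" by blast
    then have sub: "S \<subseteq> pverts G" by (auto simp: RED_LD_set_def LD_set_def)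
    have "S = pverts G"
    proof (rule ccontr)
      assume "S \<noteq> pverts G"
      then obtain x where x: "x \<in> pverts G" "x \<notin> S" using sub by blast
      have "RED_LD_set G (pverts G - {x})"
        using S(1) by (rule RED_LD_set_mono) (use sub x in auto)
      then show False using none x by blast
    qed
    then show "RED_LD G = card (pverts G)" using S by simp
  qed
qed

section \<open>Walks, cycles and short cycles in trees\<close>

lemma pcas_append: "pcas a (p @ q) b \<longleftrightarrow> (\<exists>c. pcas a p c \<and> pcas c q b)"
  by (induct p arbitrary: a) auto

lemma pcas_last_in_heads: "pcas a p b \<Longrightarrow> p \<noteq> [] \<Longrightarrow> b \<in> snd ` set p"
proof (induct p arbitrary: a)
  case (Cons e p)
  then show ?case by (cases "p = []") auto
qed simp

text \<open>Distinctness of the vertices after the first is distinctness of the heads of the arcs.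
  In this form explicit cycles are checked by simplification and cycles pass easily between two
  graphs.\<close>

lemma cycle_with_proj_iff:
  "pre_digraph.cycle (with_proj G) p \<longleftrightarrow>
     p \<noteq> [] \<and> set p \<subseteq> parcs G \<and> (\<exists>a\<in>pverts G. pcas a p a \<and> distinct (map snd p))"
proof -
  have "tl (pawalk_verts a p) = map snd p" if "pcas a p b" for a b
    using pre_digraph.awalk_verts_conv'[of "with_proj G" a p b] that
    by (simp add: cas_with_proj_eq awalk_verts_with_proj_eq split: if_splits)
  then show ?thesis
    unfolding pre_digraph.cycle_def pre_digraph.awalk_def
    by (auto simp: cas_with_proj_eq awalk_verts_with_proj_eq)
qed

lemma undirected_tree_arcs:
  assumes "undirected_tree G"
  shows "(x, y) \<in> parcs G \<Longrightarrow> (y, x) \<in> parcs G"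
    and "(x, x) \<notin> parcs G"
    and "(x, y) \<in> parcs G \<Longrightarrow> x \<in> pverts G \<and> y \<in> pverts G"
    and "finite (pverts G)"
proof -
  interpret pair_graph G using assms by (simp add: undirected_tree_def)
  show "(x, y) \<in> parcs G \<Longrightarrow> (y, x) \<in> parcs G"
    using pair_sym_arcs by (auto simp: symmetric_def sym_def)
  show "(x, x) \<notin> parcs G" using pair_no_loops[of "(x, x)"] by auto
  show "(x, y) \<in> parcs G \<Longrightarrow> x \<in> pverts G \<and> y \<in> pverts G"
    using wellformed' by blast
  show "finite (pverts G)" by (rule pair_finite_verts)
qed

lemma undirected_tree_no_triangle:
  assumes "undirected_tree G" "(x, y) \<in> parcs G" "(y, z) \<in> parcs G" "(z, x) \<in> parcs G"
  shows False
proof -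
  note arcs = undirected_tree_arcs[OF assms(1)]
  have "x \<noteq> y" "y \<noteq> z" "z \<noteq> x" using arcs(2) assms by auto
  then have "pre_digraph.cycle (with_proj G) [(x, y), (y, z), (z, x)]"
    using assms arcs(3) by (auto simp: cycle_with_proj_iff)
  then show False using assms(1) by (force simp: undirected_tree_def)
qed

text \<open>The absence of loops separates consecutive vertices; if both opposite pairs differed
  too, the closed walk \<open>x\<close>, \<open>a\<close>, \<open>y\<close>, \<open>b\<close> would
  be a cycle of length four.\<close>

lemma undirected_tree_no_square:
  assumes "undirected_tree G" "(x, a) \<in> parcs G" "(a, y) \<in> parcs G"
    "(y, b) \<in> parcs G" "(b, x) \<in> parcs G"
  shows "x = y \<or> a = b"
proof (rule ccontr)
  note arcs = undirected_tree_arcs[OF assms(1)]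
  assume "\<not> (x = y \<or> a = b)"
  moreover have "x \<noteq> a" "a \<noteq> y" "y \<noteq> b" "b \<noteq> x" using arcs(2) assms by auto
  ultimately have "pre_digraph.cycle (with_proj G) [(x, a), (a, y), (y, b), (b, x)]"
    using assms arcs(3) by (auto simp: cycle_with_proj_iff)
  then show False using assms(1) by (force simp: undirected_tree_def)
qed

lemma undirected_tree_nbhd_nonempty:
  assumes "undirected_tree G" "2 \<le> card (pverts G)" "x \<in> pverts G"
  shows "\<exists>y. (x, y) \<in> parcs G"
proof -
  have "LD_set G (pverts G - {x})"
    using RED_LD_set_pverts[OF assms(1,2)] assms(3) by (auto simp: RED_LD_set_def)
  then have "open_nbhd G x \<inter> (pverts G - {x}) \<noteq> {}"
    using assms(3) unfolding LD_set_def by blast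
  then show ?thesis by auto
qed

lemma RED_LD_set_remove1_iff:
  assumes "undirected_tree G" "2 \<le> card (pverts G)" "x \<in> pverts G"
  shows "RED_LD_set G (pverts G - {x}) \<longleftrightarrow> \<not> leaf G x \<and> \<not> support_vertex G x"
proof -
  note arcs = undirected_tree_arcs[OF assms(1)]
  note nonempty = undirected_tree_nbhd_nonempty[OF assms(1,2)]
  have sub: "open_nbhd G z \<subseteq> pverts G - {z}" for z
    using arcs by auto
  have LD1: "LD_set G (pverts G - {x})"
    using RED_LD_set_pverts[OF assms(1,2)] assms(3) by (auto simp: RED_LD_set_def)
  \<comment> \<open>Only \<open>x\<close> and \<open>y\<close> lie outside the set, so the LD
    property reduces to two domination conditions and one separation condition.\<close>
  have LD2: "LD_set G (pverts G - {x} - {y}) \<longleftrightarrow>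
      open_nbhd G x - {y} \<noteq> {} \<and> open_nbhd G y - {x} \<noteq> {} \<and>
      open_nbhd G x - {y} \<noteq> open_nbhd G y - {x}"
    if y: "y \<in> pverts G - {x}" for y
  proof -
    have "pverts G - (pverts G - {x} - {y}) = {x, y}" using y assms(3) by auto
    moreover have "open_nbhd G x \<inter> (pverts G - {x} - {y}) = open_nbhd G x - {y}"
      "open_nbhd G y \<inter> (pverts G - {x} - {y}) = open_nbhd G y - {x}"
      using sub by blast+
    ultimately show ?thesis
      using y by (simp add: LD_set_def) blast
  qed
  have leaf_or_support: "leaf G x \<or> support_vertex G x"
    if y: "y \<in> pverts G - {x}" and fail: "\<not> LD_set G (pverts G - {x} - {y})" for y
  proof -
    consider "open_nbhd G x \<subseteq> {y}" | "open_nbhd G y \<subseteq> {x}"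
      | "open_nbhd G x - {y} = open_nbhd G y - {x}" "\<not> open_nbhd G x \<subseteq> {y}"
      using LD2[OF y] fail by blast
    then show ?thesis
    proof cases
      case 1
      then have "open_nbhd G x = {y}" using nonempty[OF assms(3)] by fastforce
      then show ?thesis using assms(3) by (auto simp: leaf_iff)
    next
      case 2
      then have eq: "open_nbhd G y = {x}" using nonempty[of y] y by fastforce
      then have "leaf G y" using y by (auto simp: leaf_iff)
      moreover have "(y, x) \<in> parcs G" using eq by (simp flip: mem_open_nbhd)
      ultimately show ?thesis
        using assms(3) arcs(1) by (auto simp: support_vertex_def)
    next
      case 3
      have common: "(y, a) \<in> parcs G" if "(x, a) \<in> parcs G" "a \<noteq> y" for a
        using 3(1) that by (metis Diff_iff mem_open_nbhd singletonD)
      obtain a where "a \<in> open_nbhd G x" "a \<noteq> y" using 3(2) by blast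
      then have a: "(x, a) \<in> parcs G" "a \<noteq> y" by simp_all
      \<comment> \<open>If \<open>x\<close> and \<open>y\<close> were adjacent, they would form a
        triangle with their common neighbor \<open>a\<close>.\<close>
      have xy: "(x, y) \<notin> parcs G"
        using undirected_tree_no_triangle[OF assms(1)] common[OF a] a arcs(1) by blast
      \<comment> \<open>Another neighbor \<open>b\<close> of \<open>x\<close> would also be adjacent
        to \<open>y\<close>, closing the square \<open>x\<close>, \<open>a\<close>,
        \<open>y\<close>, \<open>b\<close>. Hence \<open>a\<close> is the only neighbor and
        \<open>x\<close> is a leaf.\<close>
      have "b = a" if b: "(x, b) \<in> parcs G" for b
      proof -
        have "b \<noteq> y" using xy b by auto
        then show ?thesis
          using undirected_tree_no_square[OF assms(1) a(1) _ common[OF b]]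
            common[OF a] b arcs(1) y by blast
      qed
      then have "open_nbhd G x = {a}" using a(1) mem_open_nbhd[of _ G x] by blast
      then show ?thesis using assms(3) by (auto simp: leaf_iff)
    qed
  qed
  \<comment> \<open>Deleting the only neighbor \<open>s\<close> of \<open>x\<close> as well leaves
    \<open>x\<close> undominated.\<close>
  have leaf_fail: False if "leaf G x" "RED_LD_set G (pverts G - {x})"
  proof -
    obtain s where s: "open_nbhd G x = {s}" using \<open>leaf G x\<close> by (auto simp: leaf_iff)
    then have "s \<in> pverts G - {x}" using sub[of x] by auto
    then show False using that(2) LD2[of s] s by (auto simp: RED_LD_set_def)
  qed
  \<comment> \<open>Deleting a leaf \<open>w\<close> at \<open>x\<close> as well leaves
    \<open>w\<close> undominated.\<close>
  have support_fail: False if x_supp: "support_vertex G x" and red: "RED_LD_set G (pverts G - {x})"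
  proof -
    obtain w where w: "(x, w) \<in> parcs G" "leaf G w"
      using x_supp by (auto simp: support_vertex_def)
    then obtain s where s: "open_nbhd G w = {s}" by (auto simp: leaf_iff)
    have "x \<in> open_nbhd G w" using w arcs(1) by simp
    then have wx: "open_nbhd G w = {x}" using s by simp
    have "w \<in> pverts G - {x}" using w arcs by auto
    then show False using red LD2[of w] wx by (auto simp: RED_LD_set_def)
  qed
  show ?thesis
    using LD1 leaf_or_support leaf_fail support_fail unfolding RED_LD_set_def by blast
qed

lemma T_max_iff:
  "T \<in> T_max \<longleftrightarrow> undirected_tree T \<and> 2 \<le> card (pverts T) \<and>
     (\<forall>x\<in>pverts T. leaf T x \<or> support_vertex T x)"
  by (auto simp: T_max_def RED_LD_eq_order_iff RED_LD_set_remove1_iff)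

section \<open>Attaching a leaf to a tree\<close>

text \<open>The new vertex is reached through \<open>u\<close>, which gives connectedness. A walk
  can enter and leave \<open>v\<close> only through \<open>u\<close>, so a cycle of length at least
  three avoids both new arcs and is already a cycle of \<open>T\<close>.\<close>

lemma undirected_tree_add_leaf:
  fixes T :: "'a pair_pre_digraph"
  assumes tree: "undirected_tree T" and u: "u \<in> pverts T" and v: "v \<notin> pverts T"
    and T': "T' = \<lparr> pverts = pverts T \<union> {v}, parcs = parcs T \<union> {(v, u), (u, v)} \<rparr>"
  shows "undirected_tree T'"
proof -
  interpret T: pair_graph T using tree by (simp add: undirected_tree_def)
  note arcs = undirected_tree_arcs[OF tree]
  have sel: "pverts T' = pverts T \<union> {v}" "parcs T' = parcs T \<union> {(v, u), (u, v)}"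
    using T' by simp_all
  have uv: "u \<noteq> v" using u v by auto
  have v_arc: "(v, a) \<notin> parcs T" "(a, v) \<notin> parcs T" for a
    using arcs(3) v by blast+
  interpret T': pair_graph T'
  proof
    fix e assume "e \<in> parcs T'"
    then show "fst e \<in> pverts T'" "snd e \<in> pverts T'" "fst e \<noteq> snd e"
      using u uv T.arc_fst_in_verts T.arc_snd_in_verts T.pair_no_loops by (auto simp: sel)
  next
    show "finite (pverts T')" "finite (parcs T')"
      using T.pair_finite_verts T.pair_finite_arcs by (auto simp: sel)
    show "symmetric (with_proj T')"
      using arcs(1) by (auto simp: symmetric_def sym_def sel)
  qed
  have subgraph: "subgraph (with_proj T) (with_proj T')"
    by (auto simp: subgraph_def sel compatible_def intro: T.wf_digraph_axioms T'.wf_digraph_axioms)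
  have "strongly_connected (with_proj T)"
    using tree T.pair_sym_arcs
    by (simp add: undirected_tree_def T.symmetric_connected_imp_strongly_connected)
  then have reach: "a \<rightarrow>\<^sup>*\<^bsub>with_proj T'\<^esub> b" if "a \<in> pverts T" "b \<in> pverts T" for a b
    using that T'.reachable_mono[OF _ subgraph] by (auto simp: strongly_connected_def)
  have "v \<rightarrow>\<^sup>*\<^bsub>with_proj T'\<^esub> u" "u \<rightarrow>\<^sup>*\<^bsub>with_proj T'\<^esub> v"
    by (auto simp: sel)
  moreover have "a \<rightarrow>\<^sup>*\<^bsub>with_proj T'\<^esub> u" "u \<rightarrow>\<^sup>*\<^bsub>with_proj T'\<^esub> a" if "a \<in> pverts T'" for a
    using that reach u calculation by (auto simp: sel)
  ultimately have "a \<rightarrow>\<^sup>*\<^bsub>with_proj T'\<^esub> b" if "a \<in> pverts T'" "b \<in> pverts T'" for a b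
    using that T'.reachable_trans by blast
  then have conn: "connected (with_proj T')"
    using u by (intro T'.connectedI T'.reachable_mk_symmetricI) (auto simp: sel)
  have "length p < 3" if cyc: "pre_digraph.cycle (with_proj T') p" for p
  proof (rule ccontr)
    assume long: "\<not> length p < 3"
    from cyc obtain a where p: "p \<noteq> []" "set p \<subseteq> parcs T'" and
      a: "a \<in> pverts T'" "pcas a p a" and dist: "distinct (map snd p)"
      by (auto simp: cycle_with_proj_iff)
    have into_v: "b = u" if "(b, v) \<in> set p" for b
      using that p(2) v_arc by (auto simp: sel)
    have from_v: "e = (v, u)" if "e \<in> set p" "fst e = v" for e
    proof -
      have "(v, snd e) \<in> parcs T'" using that p(2) by force
      then show ?thesis using that(2) v_arc by (auto simp: sel prod_eq_iff)
    qed
    \<comment> \<open>The arc after \<open>(u, v)\<close>, read cyclically, is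
      \<open>(v, u)\<close>. Its head \<open>u\<close> must be the only occurrence of
      \<open>u\<close> among the heads, but the arc before \<open>(u, v)\<close> also has head
      \<open>u\<close>. So the two are the same arc and the length is two. The cases distinguish
      whether the walk is based at \<open>v\<close>.\<close>
    have no_uv: "(u, v) \<notin> set p"
    proof
      assume "(u, v) \<in> set p"
      then obtain xs ys where p_eq: "p = xs @ (u, v) # ys" by (meson split_list)
      then have xs: "pcas a xs u" and ys: "pcas v ys a"
        using a(2) by (auto simp: pcas_append)
      show False
      proof (cases ys)
        case Nil
        then have "a = v" using ys by simp
        then have "xs \<noteq> []" using xs uv by auto
        then obtain e qs where xs_eq: "xs = e # qs" by (cases xs) auto
        then have e: "e = (v, u)" using xs \<open>a = v\<close> from_v[of e] by (simp add: p_eq)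
        then have "pcas u qs u" using xs xs_eq by simp
        then have "qs = [] \<or> u \<in> snd ` set qs" using pcas_last_in_heads by metis
        then show False using dist long by (auto simp: p_eq xs_eq e Nil)
      next
        case (Cons e zs)
        then have e: "e = (v, u)" using ys from_v[of e] by (simp add: p_eq)
        then have zs: "pcas u zs a" using ys Cons by simp
        have "u \<notin> snd ` set xs" "u \<notin> snd ` set zs"
          using dist by (auto simp: p_eq Cons e)
        moreover have "xs = [] \<or> u \<in> snd ` set xs" using xs pcas_last_in_heads by metis
        ultimately have "xs = []" by blast
        then have "a = u" using xs by simp
        then have "zs = [] \<or> u \<in> snd ` set zs" using zs pcas_last_in_heads by metis
        then have "zs = []" using \<open>u \<notin> snd ` set zs\<close> by blast
        then show False using long \<open>xs = []\<close> by (simp add: p_eq Cons)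
      qed
    qed
    \<comment> \<open>On a closed walk the tail \<open>v\<close> of an arc is also the head of an
      arc, and the only arc into \<open>v\<close> is \<open>(u, v)\<close>, already
      excluded.\<close>
    have no_vu: "(v, u) \<notin> set p"
    proof
      assume "(v, u) \<in> set p"
      then obtain xs ys where p_eq: "p = xs @ (v, u) # ys" by (meson split_list)
      then have "pcas a xs v" using a(2) by (auto simp: pcas_append)
      then have "v \<in> snd ` set xs \<or> a = v" using pcas_last_in_heads by (cases xs) force+
      moreover have "a \<in> snd ` set p" using a(2) p(1) by (rule pcas_last_in_heads)
      ultimately have "v \<in> snd ` set p" by (auto simp: p_eq)
      then show False using into_v no_uv by force
    qed
    have set_p: "set p \<subseteq> parcs T" using p(2) no_uv no_vu by (auto simp: sel)
    moreover have "a \<in> pverts T"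
      using a(2) p(1) set_p T.in_arcsD1 by (cases p) auto
    ultimately have "pre_digraph.cycle (with_proj T) p"
      using p(1) a(2) dist by (auto simp: cycle_with_proj_iff)
    then show False using tree long by (auto simp: undirected_tree_def)
  qed
  then show ?thesis
    using conn T'.pair_graph_axioms by (auto simp: undirected_tree_def not_le)
qed

section \<open>Effect of the new leaf on leaves and support vertices\<close>

theorem theorem10:
  fixes T T' :: "'a pair_pre_digraph" and u v :: 'a
  assumes "T \<in> T_max"
    and "u \<in> pverts T"
    and "v \<notin> pverts T"
    and "T' = \<lparr> pverts = pverts T \<union> {v}, parcs = parcs T \<union> {(v, u), (u, v)} \<rparr>"
  shows "T' \<in> T_max \<longleftrightarrow>
    support_vertex T u \<or>
    (leaf T u \<and> (\<exists>s \<in> open_nbhd T u. support_vertex T s \<and>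
       2 \<le> card {w \<in> open_nbhd T s. leaf T w}))"
proof -
  have tree: "undirected_tree T" and order: "2 \<le> card (pverts T)"
    and cover: "\<And>x. x \<in> pverts T \<Longrightarrow> leaf T x \<or> support_vertex T x"
    using assms(1) by (auto simp: T_max_iff)
  note arcs = undirected_tree_arcs[OF tree]
  have tree': "undirected_tree T'"
    using undirected_tree_add_leaf[OF tree assms(2-4)] .
  have verts': "pverts T' = insert v (pverts T)" using assms(4) by simp
  then have order': "2 \<le> card (pverts T')" using order assms(3) arcs(4) by simp
  have v_arc: "(v, a) \<notin> parcs T" "(a, v) \<notin> parcs T" for a
    using arcs(3) assms(3) by blast+
  have nbhd_v: "open_nbhd T' v = {u}"
    using assms(4) v_arc by auto
  have nbhd_u: "open_nbhd T' u = insert v (open_nbhd T u)"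
    using assms(2-4) by auto
  have nbhd: "open_nbhd T' x = open_nbhd T x" if "x \<noteq> u" "x \<noteq> v" for x
    using assms(4) that by auto
  obtain t where t: "(u, t) \<in> parcs T"
    using undirected_tree_nbhd_nonempty[OF tree order assms(2)] by blast
  have leaf_v: "leaf T' v" using nbhd_v by (auto simp: leaf_iff verts')
  \<comment> \<open>The old neighbor \<open>t\<close> and the new neighbor \<open>v\<close> are
    distinct.\<close>
  have not_leaf_u: "\<not> leaf T' u"
  proof
    assume "leaf T' u"
    then obtain s where s: "open_nbhd T' u = {s}" by (auto simp: leaf_iff)
    have "t \<in> open_nbhd T' u" "v \<in> open_nbhd T' u" using nbhd_u t by auto
    then show False using s t v_arc by auto
  qed
  have leaf': "leaf T' x \<longleftrightarrow> leaf T x" if "x \<noteq> u" "x \<noteq> v" for x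
    using that nbhd by (auto simp: leaf_iff verts')
  have support_u: "support_vertex T' u"
    using leaf_v nbhd_u assms(2) by (auto simp: support_vertex_def verts')
  \<comment> \<open>Away from \<open>u\<close> and \<open>v\<close> neighborhoods are unchanged, so
    the only change is that \<open>u\<close> no longer counts as a leaf.\<close>
  have support': "support_vertex T' x \<longleftrightarrow> (\<exists>w. (x, w) \<in> parcs T \<and> w \<noteq> u \<and> leaf T w)"
    if x: "x \<in> pverts T" "x \<noteq> u" for x
  proof -
    have "x \<noteq> v" using x assms(3) by auto
    then have "support_vertex T' x \<longleftrightarrow> (\<exists>w\<in>open_nbhd T x. leaf T' w)"
      using x nbhd[of x] by (simp add: support_vertex_def verts')
    also have "\<dots> \<longleftrightarrow> (\<exists>w. (x, w) \<in> parcs T \<and> w \<noteq> u \<and> leaf T w)"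
      using leaf' not_leaf_u v_arc by (metis mem_open_nbhd)
    finally show ?thesis .
  qed
  \<comment> \<open>In \<open>T'\<close> the vertex \<open>v\<close> is a leaf and \<open>u\<close>
    supports it, so only the remaining vertices need checking.\<close>
  have T'_iff: "T' \<in> T_max \<longleftrightarrow>
      (\<forall>x\<in>pverts T - {u}. leaf T x \<or> (\<exists>w. (x, w) \<in> parcs T \<and> w \<noteq> u \<and> leaf T w))"
  proof -
    have "T' \<in> T_max \<longleftrightarrow> (\<forall>x\<in>pverts T - {u}. leaf T' x \<or> support_vertex T' x)"
      unfolding T_max_iff using tree' order' leaf_v support_u by (auto simp: verts')
    also have "\<dots> \<longleftrightarrow>
        (\<forall>x\<in>pverts T - {u}. leaf T x \<or> (\<exists>w. (x, w) \<in> parcs T \<and> w \<noteq> u \<and> leaf T w))"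
      using assms(3) by (intro ball_cong refl) (use leaf' support' in auto)
    finally show ?thesis .
  qed
  show ?thesis
  proof (cases "leaf T u")
    case False
    then have "support_vertex T u" using cover assms(2) by blast
    \<comment> \<open>As \<open>u\<close> is not a leaf of \<open>T\<close>, every leaf that gives
      support in \<open>T\<close> differs from \<open>u\<close>, and no support is lost.\<close>
    moreover have "T' \<in> T_max"
      unfolding T'_iff using cover False unfolding support_vertex_def by fastforce
    ultimately show ?thesis by blast
  next
    case True
    have t_verts: "t \<in> pverts T - {u}" using t arcs by auto
    have nbhd_T_u: "open_nbhd T u = {t}"
      using True t by (auto simp: leaf_iff simp flip: mem_open_nbhd)
    have only_t: "x = t" if "(x, u) \<in> parcs T" for x
    proof -
      have "x \<in> open_nbhd T u" using that arcs(1) by simp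
      then show ?thesis using nbhd_T_u by simp
    qed
    let ?L = "{w \<in> open_nbhd T t. leaf T w}"
    \<comment> \<open>Only the single neighbor \<open>t\<close> of \<open>u\<close> can lose support
      when \<open>u\<close> ceases to be a leaf, so the condition has to be tested at
      \<open>t\<close> alone.\<close>
    have "T' \<in> T_max \<longleftrightarrow> leaf T t \<or> (\<exists>w. (t, w) \<in> parcs T \<and> w \<noteq> u \<and> leaf T w)"
      unfolding T'_iff
    proof
      assume t_ok: "leaf T t \<or> (\<exists>w. (t, w) \<in> parcs T \<and> w \<noteq> u \<and> leaf T w)"
      show "\<forall>x\<in>pverts T - {u}. leaf T x \<or> (\<exists>w. (x, w) \<in> parcs T \<and> w \<noteq> u \<and> leaf T w)"
      proof
        fix x assume x: "x \<in> pverts T - {u}"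
        show "leaf T x \<or> (\<exists>w. (x, w) \<in> parcs T \<and> w \<noteq> u \<and> leaf T w)"
          using t_ok cover[of x] x only_t by (cases "x = t") (auto simp: support_vertex_def)
      qed
    qed (use t_verts in blast)
    moreover have "leaf T t \<longleftrightarrow> support_vertex T u"
      using nbhd_T_u assms(2) by (simp add: support_vertex_def)
    \<comment> \<open>The leaf \<open>u\<close> is itself counted in \<open>?L\<close>, so one
      further leaf at \<open>t\<close> means a count of at least two.\<close>
    moreover have "(\<exists>w. (t, w) \<in> parcs T \<and> w \<noteq> u \<and> leaf T w) \<longleftrightarrow> 2 \<le> card ?L"
    proof -
      have "?L \<subseteq> pverts T" using arcs(3) by auto
      then have fin: "finite ?L" using arcs(4) finite_subset by blast
      have u_L: "u \<in> ?L" using True t arcs(1) by simp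
      have "2 \<le> card ?L \<longleftrightarrow> ?L - {u} \<noteq> {}"
      proof -
        have "card ?L = Suc (card (?L - {u}))" using fin u_L by (rule card.remove)
        moreover have "card (?L - {u}) = 0 \<longleftrightarrow> ?L - {u} = {}" using fin by simp
        ultimately show ?thesis by linarith
      qed
      then show ?thesis by auto
    qed
    moreover have "support_vertex T t"
      using True t arcs(1) t_verts by (auto simp: support_vertex_def)
    ultimately show ?thesis using True nbhd_T_u by simp
  qed
qed

end
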